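(* Let $y,\rho,q\in\mathbb{R}$. For every integer $n\ge1$ (such that $\det S_n(y|q,\rho)\neq0$, so that the quotient is defined), $$\frac{\det S_{n+1}(y|q,\rho)}{\det S_n(y|q,\rho)}=[n]_q!\prod_{i=1}^{n}\left(1-\rho^2q^{i-1}\right).$$
   Context: Notation: $[n]_q=1+q+\dots+q^{n-1}$, $[0]_q=0$; $[n]_q!=[1]_q[2]_q\cdots[n]_q$. The convention $q^0=1$ is used also for $q=0$. The (renormalized) continuous $q$-Hermite polynomials $H_n(x|q)$ are defined by $H_{-1}=0$, $H_0=1$ and $H_{n+1}(x)=xH_n(x)-[n]_qH_{n-1}(x)$ for $n\ge0$. Let $a_{n,2i}$, $0\le i\le\lfloor n/2\rfloor$, be the coefficients in the expansion of the monomial $x^n$ into $q$-Hermite polynomials, $x^n=\sum_{i=0}^{\lfloor n/2\rfloor}a_{n,2i}H_{n-2i}(x|q)$, $n\ge0$. Define $$m_n(y)=\sum_{k=0}^{\lfloor n/2\rfloor}\rho^{n-2k}a_{n,2k}H_{n-2k}(y|q),\quad n\ge 0.$$ (These are the moments $m_n(y)=\int x^n\mu(dx)$ of a, perhaps signed, measure $\mu=\mu_{y,\rho}$ of total mass $1$ satisfying $\int H_n(x|q)\mu(dx)=\rho^nH_n(y|q)$ for $n=1,2,\dots$.) Let $S_n(y|q,\rho)=[m_{i+j}(y)]_{i,j=0,\dots,n-1}$ be the $n\times n$ Hankel matrix of these moments. *)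

theory Defs
  imports "Jordan_Normal_Form.Determinant" "HOL-Computational_Algebra.Polynomial"
begin

definition q_int :: "real \<Rightarrow> nat \<Rightarrow> real" where
  "q_int q n = (\<Sum>i<n. q ^ i)"

definition q_fact :: "real \<Rightarrow> nat \<Rightarrow> real" where
  "q_fact q n = (\<Prod>k=1..n. q_int q k)"

text \<open>The second equation is the recurrence at \<open>n = 0\<close>, where the index \<open>-1\<close> term vanishes.\<close>

fun q_Hermite :: "real \<Rightarrow> nat \<Rightarrow> real poly" where
  "q_Hermite q 0 = 1"
| "q_Hermite q (Suc 0) = [:0, 1:]"
| "q_Hermite q (Suc (Suc n)) =
     [:0, 1:] * q_Hermite q (Suc n) - smult (q_int q (Suc n)) (q_Hermite q n)"

text \<open>\<open>q_Hermite_coeff q n i\<close> is the coefficient of \<open>H\<^bsub>n-2i\<^esub>\<close> in the expansion of \<open>x\<^sup>n\<close>,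
  that is, \<open>a\<^bsub>n,2i\<^esub>\<close>. The expansion determines the coefficients only for \<open>i \<le> n div 2\<close>;
  the others are set to zero so that the description is unique
  (see \<open>ex1_monom_expansion\<close>).\<close>

definition is_monom_expansion :: "real \<Rightarrow> nat \<Rightarrow> (nat \<Rightarrow> real) \<Rightarrow> bool" where
  "is_monom_expansion q n a \<longleftrightarrow>
     (\<forall>i > n div 2. a i = 0) \<and>
     monom 1 n = (\<Sum>i\<le>n div 2. smult (a i) (q_Hermite q (n - 2 * i)))"

definition q_Hermite_coeff :: "real \<Rightarrow> nat \<Rightarrow> nat \<Rightarrow> real" where
  "q_Hermite_coeff q n = (THE a. is_monom_expansion q n a)"

definition moment :: "real \<Rightarrow> real \<Rightarrow> real \<Rightarrow> nat \<Rightarrow> real" where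
  "moment q \<rho> y n =
     (\<Sum>k\<le>n div 2. \<rho> ^ (n - 2 * k) * q_Hermite_coeff q n k * poly (q_Hermite q (n - 2 * k)) y)"

definition moment_Hankel :: "real \<Rightarrow> real \<Rightarrow> real \<Rightarrow> nat \<Rightarrow> real mat" where
  "moment_Hankel q \<rho> y n = mat n n (\<lambda>(i, j). moment q \<rho> y (i + j))"

lemma degree_q_Hermite_le: "degree (q_Hermite q n) \<le> n"
  and coeff_q_Hermite_self: "coeff (q_Hermite q n) n = 1"
proof -
  have "degree (q_Hermite q n) \<le> n \<and> coeff (q_Hermite q n) n = 1"
  proof (induction q n rule: q_Hermite.induct)
    case (3 q n)
    have *: "coeff (q_Hermite q n) k = 0" if "k > n" for k
      using 3 that by (auto intro: coeff_eq_0)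
    have **: "coeff (q_Hermite q (Suc n)) k = 0" if "k > Suc n" for k
      using 3 that by (auto intro: coeff_eq_0)
    have c: "coeff (q_Hermite q (Suc (Suc n))) (Suc k) =
        coeff (q_Hermite q (Suc n)) k - q_int q (Suc n) * coeff (q_Hermite q n) (Suc k)" for k
      by simp
    have "coeff (q_Hermite q (Suc (Suc n))) k = 0" if "k > Suc (Suc n)" for k
    proof -
      obtain l where "k = Suc l" using \<open>k > Suc (Suc n)\<close> by (cases k) auto
      with that show ?thesis using c[of l] * ** by simp
    qed
    moreover have "coeff (q_Hermite q (Suc (Suc n))) (Suc (Suc n)) = 1"
      using c[of "Suc n"] * 3 by simp
    ultimately show ?case by (intro conjI degree_le) auto
  qed simp_all
  then show "degree (q_Hermite q n) \<le> n" "coeff (q_Hermite q n) n = 1" by auto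
qed

lemma ex_monom_expansion: "\<exists>a. is_monom_expansion q n a"
proof (induction n)
  case 0
  show ?case
    by (rule exI[of _ "\<lambda>i. if i = 0 then 1 else 0"]) (simp add: is_monom_expansion_def)
next
  case (Suc n)
  then obtain a where z: "\<And>i. i > n div 2 \<Longrightarrow> a i = 0"
    and e: "monom 1 n = (\<Sum>i\<le>n div 2. smult (a i) (q_Hermite q (n - 2 * i)))"
    by (auto simp: is_monom_expansion_def)
  define c where "c i = q_int q (n - 2 * i) * a i" for i
  define b where "b i = a i + (case i of 0 \<Rightarrow> 0 | Suc j \<Rightarrow> c j)" for i
  have q0: "q_int q 0 = 0" by (simp add: q_int_def)
  have step: "[:0, 1:] * q_Hermite q k = q_Hermite q (Suc k) + smult (q_int q k) (q_Hermite q (k - 1))" for k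
    by (cases k) (simp_all add: q0)
  have c0: "c i = 0" if "Suc i > Suc n div 2" for i
    using that z[of i] q0 by (cases "2 * i = n") (auto simp: c_def)
  have b0: "b i = 0" if "i > Suc n div 2" for i
    using that z[of i] c0 by (cases i) (auto simp: b_def)
  have "monom 1 (Suc n) = [:0, 1:] * (monom 1 n :: real poly)"
    by (simp add: monom_Suc)
  also have "\<dots> = (\<Sum>i\<le>n div 2. smult (a i) ([:0, 1:] * q_Hermite q (n - 2 * i)))"
    unfolding e sum_distrib_left by simp
  also have "\<dots> = (\<Sum>i\<le>n div 2. smult (a i) (q_Hermite q (Suc n - 2 * i))
      + smult (c i) (q_Hermite q (Suc n - 2 * Suc i)))"
  proof (rule sum.cong[OF refl])
    fix i assume "i \<in> {..n div 2}"
    then have "Suc (n - 2 * i) = Suc n - 2 * i" "n - 2 * i - 1 = Suc n - 2 * Suc i" by auto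
    then show "smult (a i) ([:0, 1:] * q_Hermite q (n - 2 * i)) =
      smult (a i) (q_Hermite q (Suc n - 2 * i)) + smult (c i) (q_Hermite q (Suc n - 2 * Suc i))"
      unfolding step c_def by (simp add: smult_add_right mult.commute)
  qed
  also have "\<dots> = (\<Sum>i\<le>Suc n. smult (a i) (q_Hermite q (Suc n - 2 * i)))
      + (\<Sum>i\<le>n. smult (c i) (q_Hermite q (Suc n - 2 * Suc i)))"
    unfolding sum.distrib
    by (intro arg_cong2[where f = "(+)"] sum.mono_neutral_left) (auto simp: z c_def)
  also have "\<dots> = (\<Sum>i\<le>Suc n. smult (b i) (q_Hermite q (Suc n - 2 * i)))"
    by (simp add: b_def sum.atMost_Suc_shift smult_add_left sum.distrib del: sum.atMost_Suc)
  also have "\<dots> = (\<Sum>i\<le>Suc n div 2. smult (b i) (q_Hermite q (Suc n - 2 * i)))"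
    by (rule sum.mono_neutral_right) (auto simp: b0)
  finally show ?case using b0 by (auto simp: is_monom_expansion_def)
qed

lemma monom_expansion_unique:
  assumes "is_monom_expansion q n a" "is_monom_expansion q n b"
  shows "a = b"
proof
  fix i
  show "a i = b i"
  proof (induction i rule: less_induct)
    case (less i)
    show ?case
    proof (cases "i \<le> n div 2")
      case True
      have "coeff (\<Sum>j\<le>n div 2. smult (a j - b j) (q_Hermite q (n - 2 * j))) (n - 2 * i) =
          (\<Sum>j\<le>n div 2. (a j - b j) * coeff (q_Hermite q (n - 2 * j)) (n - 2 * i))"
        by (simp add: coeff_sum)
      also have "\<dots> = (\<Sum>j\<in>{i}. (a j - b j) * coeff (q_Hermite q (n - 2 * j)) (n - 2 * i))"
      proof (rule sum.mono_neutral_right)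
        show "\<forall>j\<in>{..n div 2} - {i}. (a j - b j) * coeff (q_Hermite q (n - 2 * j)) (n - 2 * i) = 0"
        proof
          fix j assume j: "j \<in> {..n div 2} - {i}"
          show "(a j - b j) * coeff (q_Hermite q (n - 2 * j)) (n - 2 * i) = 0"
          proof (cases "j < i")
            case False
            then have "degree (q_Hermite q (n - 2 * j)) < n - 2 * i"
              using j by (intro le_less_trans[OF degree_q_Hermite_le]) auto
            then show ?thesis by (simp add: coeff_eq_0)
          qed (simp add: less)
        qed
      qed (use True in auto)
      also have "\<dots> = a i - b i" by (simp add: coeff_q_Hermite_self)
      also have "(\<Sum>j\<le>n div 2. smult (a j - b j) (q_Hermite q (n - 2 * j))) = 0"
        using assms by (simp add: is_monom_expansion_def smult_diff_left sum_subtractf)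
      finally show ?thesis by simp
    qed (use assms in \<open>auto simp: is_monom_expansion_def\<close>)
  qed
qed

lemma ex1_monom_expansion: "\<exists>!a. is_monom_expansion q n a"
  using ex_monom_expansion monom_expansion_unique by blast

lemma is_monom_expansion_q_Hermite_coeff: "is_monom_expansion q n (q_Hermite_coeff q n)"
  unfolding q_Hermite_coeff_def by (rule theI'[OF ex1_monom_expansion])

end

theory Submission
  imports Defs
begin

text \<open>
  The moments turn out to be those of the Jacobi matrix with diagonal \<open>\<rho> y q\<^sup>k\<close> and
  off-diagonal products \<open>[k+1] (1 - \<rho>\<^sup>2 q\<^sup>k)\<close> (the one of the Al-Salam--Chihara polynomials \<open>P\<^sub>k\<close>).
  If \<open>A\<^sub>n\<^sub>k\<close> is the coefficient of \<open>P\<^sub>k\<close> in \<open>x\<^sup>n\<close>, then the Hankel matrix factors as \<open>A D A\<^sup>T\<close> with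
  \<open>A\<close> lower unitriangular and \<open>D\<close> diagonal, which gives the determinants. That \<open>A\<^sub>n\<^sub>0\<close> is the
  \<open>n\<close>-th moment follows from the connection formula
  \<open>H\<^sub>n(x) = \<Sum>\<^sub>k binom(n,k)\<^sub>q \<rho>\<^sup>n\<^sup>-\<^sup>k H\<^sub>n\<^sub>-\<^sub>k(y) P\<^sub>k(x)\<close>, read off at \<open>k = 0\<close>. The polynomials \<open>P\<^sub>k\<close>
  themselves are never needed, only the functionals extracting the coefficient of \<open>P\<^sub>k\<close>.
\<close>

section \<open>Hankel determinants of the moments of a Jacobi matrix\<close>

text \<open>\<open>Jacobi_coeff b c n k\<close> is the coefficient of \<open>P\<^sub>k\<close> in \<open>x\<^sup>n\<close>, where
  \<open>x P\<^sub>k = P\<^bsub>k+1\<^esub> + b\<^sub>k P\<^sub>k + c\<^bsub>k-1\<^esub> P\<^bsub>k-1\<^esub>\<close>; note the index shift in \<open>c\<close>.\<close>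

fun Jacobi_coeff :: "(nat \<Rightarrow> 'a::comm_ring_1) \<Rightarrow> (nat \<Rightarrow> 'a) \<Rightarrow> nat \<Rightarrow> nat \<Rightarrow> 'a" where
  "Jacobi_coeff b c 0 0 = 1"
| "Jacobi_coeff b c 0 (Suc k) = 0"
| "Jacobi_coeff b c (Suc n) 0 = b 0 * Jacobi_coeff b c n 0 + c 0 * Jacobi_coeff b c n 1"
| "Jacobi_coeff b c (Suc n) (Suc k) =
     Jacobi_coeff b c n k + b (Suc k) * Jacobi_coeff b c n (Suc k)
       + c (Suc k) * Jacobi_coeff b c n (Suc (Suc k))"

lemma Jacobi_coeff_eq_0: "k > n \<Longrightarrow> Jacobi_coeff b c n k = 0"
  by (induction b c n k rule: Jacobi_coeff.induct) auto

lemma Jacobi_coeff_self: "Jacobi_coeff b c n n = 1"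
  by (induction n) (auto simp: Jacobi_coeff_eq_0)

text \<open>Multiplication by x is symmetric for the form in which the P_k are orthogonal with
  squared norms \<open>h k\<close>.\<close>

lemma Jacobi_coeff_Gram_shift:
  fixes b c :: "nat \<Rightarrow> 'a::comm_ring_1"
  defines "A \<equiv> Jacobi_coeff b c" and "h \<equiv> \<lambda>k. \<Prod>i<k. c i"
  assumes "i \<le> N" "j \<le> N"
  shows "(\<Sum>k\<le>N. A (Suc i) k * h k * A j k) = (\<Sum>k\<le>N. A i k * h k * A (Suc j) k)"
proof -
  define T where "T i j = (\<Sum>k\<le>N. A i (Suc k) * h (Suc k) * A j k)" for i j
  \<comment> \<open>Since \<open>c k * h k = h (Suc k)\<close>, the outer terms of the recurrence
    become \<open>T j i\<close> and \<open>T i j\<close>, which swap with i and j.\<close>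
  have expand: "(\<Sum>k\<le>N. A (Suc i) k * h k * A j k) =
      T j i + (\<Sum>k\<le>N. b k * A i k * h k * A j k) + T i j" if "j \<le> N" for i j
  proof -
    have "A (Suc i) k * h k * A j k =
        (case k of 0 \<Rightarrow> 0 | Suc l \<Rightarrow> A j (Suc l) * h (Suc l) * A i l)
          + b k * A i k * h k * A j k + A i (Suc k) * h (Suc k) * A j k" for k
      by (cases k) (simp_all add: A_def h_def algebra_simps)
    moreover have "(\<Sum>k\<le>N. case k of 0 \<Rightarrow> 0 | Suc l \<Rightarrow> A j (Suc l) * h (Suc l) * A i l) = T j i"
    proof -
      have "T j i = (\<Sum>k\<le>Suc N. case k of 0 \<Rightarrow> 0 | Suc l \<Rightarrow> A j (Suc l) * h (Suc l) * A i l)"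
        unfolding T_def by (subst sum.atMost_Suc_shift) simp
      \<comment> \<open>The extra term at \<open>Suc N\<close> contains \<open>A j (Suc N)\<close>,
        which vanishes because j \<le> N.\<close>
      then show ?thesis using that by (simp add: A_def Jacobi_coeff_eq_0)
    qed
    ultimately show ?thesis by (simp add: sum.distrib T_def)
  qed
  have "(\<Sum>k\<le>N. A i k * h k * A (Suc j) k) = (\<Sum>k\<le>N. A (Suc j) k * h k * A i k)"
    by (simp add: mult_ac)
  then show ?thesis
    using expand[of j i] expand[of i j] assms(3,4) by (simp add: mult_ac add_ac)
qed

text \<open>Factors x move one by one from the first argument to the second, keeping i + j fixed; at
  i = 0 only k = 0 survives.\<close>

lemma Jacobi_coeff_Gram:
  assumes "i + j \<le> N"
  shows "(\<Sum>k\<le>N. Jacobi_coeff b c i k * (\<Prod>l<k. c l) * Jacobi_coeff b c j k) =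
    Jacobi_coeff b c (i + j) 0"
  using assms
proof (induction i arbitrary: j)
  case 0
  have "Jacobi_coeff b c 0 k = (if k = 0 then 1 else 0)" for k by (cases k) auto
  then show ?case by (simp add: if_distrib[of "\<lambda>x. x * _"] cong: if_cong)
next
  case (Suc i)
  then show ?case using Suc.IH[of "Suc j"] Jacobi_coeff_Gram_shift[of i N j b c] by simp
qed

lemma det_Hankel_Jacobi_coeff:
  fixes b c :: "nat \<Rightarrow> 'a::idom"
  shows "det (mat n n (\<lambda>(i, j). Jacobi_coeff b c (i + j) 0)) = (\<Prod>k<n. \<Prod>i<k. c i)"
proof -
  define A where "A = mat n n (\<lambda>(i, j). Jacobi_coeff b c i j)"
  define D where "D = mat n n (\<lambda>(i, j). if i = j then \<Prod>l<i. c l else 0)"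
  have carrier: "A \<in> carrier_mat n n" "D \<in> carrier_mat n n" by (auto simp: A_def D_def)
  have "mat n n (\<lambda>(i, j). Jacobi_coeff b c (i + j) 0) = (A * D) * A\<^sup>T"
  proof (rule eq_matI)
    fix i j assume ij: "i < dim_row ((A * D) * A\<^sup>T)" "j < dim_col ((A * D) * A\<^sup>T)"
    then have "i < n" "j < n" by (auto simp: A_def)
    \<comment> \<open>The bound i + j + n suffices for the Gram identity and covers all k < n; terms
      with k > i vanish.\<close>
    have "Jacobi_coeff b c (i + j) 0 =
        (\<Sum>k\<le>i + j + n. Jacobi_coeff b c i k * (\<Prod>l<k. c l) * Jacobi_coeff b c j k)"
      by (simp add: Jacobi_coeff_Gram)
    also have "\<dots> = (\<Sum>k\<in>{0..<n}. Jacobi_coeff b c i k * (\<Prod>l<k. c l) * Jacobi_coeff b c j k)"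
      using \<open>i < n\<close> by (intro sum.mono_neutral_right) (auto simp: Jacobi_coeff_eq_0)
    also have "\<dots> = ((A * D) * A\<^sup>T) $$ (i, j)"
      using \<open>i < n\<close> \<open>j < n\<close>
      by (simp add: A_def D_def scalar_prod_def if_distrib[of "\<lambda>x. _ * x"] cong: if_cong)
    finally show "mat n n (\<lambda>(i, j). Jacobi_coeff b c (i + j) 0) $$ (i, j) = ((A * D) * A\<^sup>T) $$ (i, j)"
      using \<open>i < n\<close> \<open>j < n\<close> by simp
  qed (auto simp: A_def)
  then have "det (mat n n (\<lambda>(i, j). Jacobi_coeff b c (i + j) 0)) = det A * det D * det A"
    using carrier by (simp add: det_mult[of _ n] det_transpose[of _ n])
  moreover have "det A = 1"
    by (subst det_lower_triangular[of n])
      (auto simp: A_def Jacobi_coeff_eq_0 Jacobi_coeff_self prod_list_diag_prod)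
  moreover have "det D = (\<Prod>k<n. \<Prod>i<k. c i)"
    by (subst det_lower_triangular[of n])
      (auto simp: D_def prod_list_diag_prod lessThan_atLeast0)
  ultimately show ?thesis by simp
qed

section \<open>Linear functionals on polynomials\<close>

definition poly_functional :: "(nat \<Rightarrow> 'a::comm_ring_1) \<Rightarrow> 'a poly \<Rightarrow> 'a" where
  "poly_functional m p = (\<Sum>i\<le>degree p. coeff p i * m i)"

lemma poly_functional_altdef:
  assumes "degree p \<le> N"
  shows "poly_functional m p = (\<Sum>i\<le>N. coeff p i * m i)"
  unfolding poly_functional_def
  using assms by (intro sum.mono_neutral_left) (auto simp: coeff_eq_0)

lemma poly_functional_0 [simp]: "poly_functional m 0 = 0"
  by (simp add: poly_functional_def)

lemma poly_functional_1 [simp]: "poly_functional m 1 = m 0"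
  by (simp add: poly_functional_def)

lemma poly_functional_add: "poly_functional m (p + r) = poly_functional m p + poly_functional m r"
proof -
  define N where "N = max (degree p) (degree r)"
  have "degree p \<le> N" "degree r \<le> N" "degree (p + r) \<le> N"
    by (auto simp: N_def degree_add_le)
  then show ?thesis by (simp add: poly_functional_altdef algebra_simps sum.distrib)
qed

lemma poly_functional_smult: "poly_functional m (smult a p) = a * poly_functional m p"
  by (simp add: poly_functional_altdef[of _ "degree p"] degree_smult_le sum_distrib_left mult_ac)

lemma poly_functional_diff: "poly_functional m (p - r) = poly_functional m p - poly_functional m r"
  using poly_functional_add[of m "p - r" r] by simp

lemma poly_functional_sum: "poly_functional m (\<Sum>x\<in>X. f x) = (\<Sum>x\<in>X. poly_functional m (f x))"
  by (induction X rule: infinite_finite_induct) (simp_all add: poly_functional_add)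

lemma poly_functional_monom: "poly_functional m (monom 1 n) = m n"
  by (simp add: poly_functional_altdef[of _ n] degree_monom_le if_distrib[of "\<lambda>x. x * _"] cong: if_cong)

lemma poly_functional_pCons: "poly_functional m (pCons 0 p) = poly_functional (\<lambda>i. m (Suc i)) p"
proof -
  have "poly_functional m (pCons 0 p) = (\<Sum>i\<le>Suc (degree p). coeff (pCons 0 p) i * m i)"
    by (rule poly_functional_altdef) (simp add: degree_pCons_le)
  also have "\<dots> = poly_functional (\<lambda>i. m (Suc i)) p"
    by (subst sum.atMost_Suc_shift) (simp add: poly_functional_def)
  finally show ?thesis .
qed

lemma poly_functional_lincomb:
  "poly_functional (\<lambda>i. a * f i + b * g i) p = a * poly_functional f p + b * poly_functional g p"
  by (simp add: poly_functional_def algebra_simps sum.distrib sum_distrib_left)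

section \<open>Gaussian binomial coefficients\<close>

lemma q_int_0 [simp]: "q_int q 0 = 0"
  by (simp add: q_int_def)

lemma q_int_add: "q_int q (m + n) = q_int q m + q ^ m * q_int q n"
  by (induction n) (simp_all add: q_int_def power_add algebra_simps)

text \<open>The q-Pascal rule replaces the quotient of q-factorials, which breaks down when some
  \<open>q_int q k\<close> is zero, as at q = -1.\<close>

fun q_binom :: "real \<Rightarrow> nat \<Rightarrow> nat \<Rightarrow> real" where
  "q_binom q n 0 = 1"
| "q_binom q 0 (Suc k) = 0"
| "q_binom q (Suc n) (Suc k) = q_binom q n k + q ^ Suc k * q_binom q n (Suc k)"

lemma q_binom_eq_0: "k > n \<Longrightarrow> q_binom q n k = 0"
  by (induction q n k rule: q_binom.induct) auto

lemma q_binom_absorb_of_step: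
  assumes "q_int q (Suc k) * q_binom q n (Suc k) = q_int q (n - k) * q_binom q n k"
  shows "q_int q (Suc k) * q_binom q (Suc n) (Suc k) = q_int q (Suc n) * q_binom q n k"
proof (cases "k \<le> n")
  case True
  then have "q_int q (Suc n) = q_int q (Suc k) + q ^ Suc k * q_int q (n - k)"
    using q_int_add[of q "Suc k" "n - k"] by simp
  have "q_int q (Suc k) * q_binom q (Suc n) (Suc k) =
      q_int q (Suc k) * q_binom q n k + q ^ Suc k * (q_int q (Suc k) * q_binom q n (Suc k))"
    by (simp add: algebra_simps)
  also have "\<dots> = (q_int q (Suc k) + q ^ Suc k * q_int q (n - k)) * q_binom q n k"
    unfolding assms by (simp add: algebra_simps)
  finally show ?thesis by (simp only: \<open>q_int q (Suc n) = _\<close>)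
qed (simp add: q_binom_eq_0)

text \<open>For k = j + 1 in the induction step, both sides equal [n+1] binom(n, j+1): the left by
  absorption, the right by Pascal and the induction hypothesis.\<close>

lemma q_binom_step: "q_int q (Suc k) * q_binom q n (Suc k) = q_int q (n - k) * q_binom q n k"
proof (induction n arbitrary: k)
  case (Suc n)
  have absorb: "q_int q (Suc k) * q_binom q (Suc n) (Suc k) = q_int q (Suc n) * q_binom q n k" for k
    by (rule q_binom_absorb_of_step[OF Suc.IH])
  show ?case
  proof (cases k)
    case 0
    then show ?thesis using absorb[of 0] by simp
  next
    case (Suc j)
    show ?thesis
    proof (cases "j < n")
      case True
      then have split: "q_int q (Suc n) = q_int q (Suc j) + q ^ Suc j * q_int q (n - j)"
        using q_int_add[of q "Suc j" "n - j"] by simp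
      have "q_int q (n - j) * q_binom q (Suc n) (Suc j) =
          q_int q (n - j) * q_binom q n j + q ^ Suc j * q_int q (n - j) * q_binom q n (Suc j)"
        by (simp add: algebra_simps)
      also have "\<dots> = q_int q (Suc n) * q_binom q n (Suc j)"
        unfolding split Suc.IH[of j, symmetric] by (simp add: algebra_simps)
      finally show ?thesis using absorb[of "Suc j"] Suc by simp
    next
      case False
      then show ?thesis using Suc by (simp add: q_binom_eq_0)
    qed
  qed
qed simp

lemma q_binom_absorb: "q_int q (Suc k) * q_binom q (Suc n) (Suc k) = q_int q (Suc n) * q_binom q n k"
  by (rule q_binom_absorb_of_step[OF q_binom_step])

section \<open>The connection formula\<close>

abbreviation ASC_diag :: "real \<Rightarrow> real \<Rightarrow> real \<Rightarrow> nat \<Rightarrow> real" where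
  "ASC_diag q \<rho> y k \<equiv> \<rho> * y * q ^ k"

abbreviation ASC_offdiag :: "real \<Rightarrow> real \<Rightarrow> nat \<Rightarrow> real" where
  "ASC_offdiag q \<rho> k \<equiv> q_int q (Suc k) * (1 - \<rho>\<^sup>2 * q ^ k)"

definition ASC_functional :: "real \<Rightarrow> real \<Rightarrow> real \<Rightarrow> nat \<Rightarrow> real poly \<Rightarrow> real" where
  "ASC_functional q \<rho> y k =
     poly_functional (\<lambda>n. Jacobi_coeff (ASC_diag q \<rho> y) (ASC_offdiag q \<rho>) n k)"

lemma ASC_functional_mult_x:
  "ASC_functional q \<rho> y k (pCons 0 p) =
     (case k of 0 \<Rightarrow> 0 | Suc l \<Rightarrow> ASC_functional q \<rho> y l p)
     + ASC_diag q \<rho> y k * ASC_functional q \<rho> y k p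
     + ASC_offdiag q \<rho> k * ASC_functional q \<rho> y (Suc k) p"
proof (cases k)
  case 0
  then show ?thesis
    by (simp add: ASC_functional_def poly_functional_pCons poly_functional_lincomb)
next
  case (Suc l)
  let ?A = "Jacobi_coeff (ASC_diag q \<rho> y) (ASC_offdiag q \<rho>)"
  \<comment> \<open>The factors 1 put the three terms into the form of two nested binary
    combinations.\<close>
  have "poly_functional (\<lambda>n. ?A (Suc n) (Suc l)) p =
    poly_functional (\<lambda>n. 1 * (1 * ?A n l + ASC_diag q \<rho> y (Suc l) * ?A n (Suc l))
      + ASC_offdiag q \<rho> (Suc l) * ?A n (Suc (Suc l))) p"
    by simp
  then show ?thesis
    unfolding poly_functional_lincomb Suc by (simp add: ASC_functional_def poly_functional_pCons)
qed

lemma poly_q_Hermite_mult_x: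
  "y * poly (q_Hermite q n) y =
     poly (q_Hermite q (Suc n)) y + q_int q n * poly (q_Hermite q (n - 1)) y"
  by (cases n) simp_all

text \<open>With \<open>F n k\<close> as coefficient of P_k in H_n, this compares coefficients in x
  H_n = H_{n+1} + [n] H_{n-1}. The two parts of 1 - \<rho>^2 q^k are treated separately in
  \<open>lower\<close> and \<open>upper\<close>.\<close>

lemma q_connection_recurrence:
  fixes q \<rho> y :: real
  defines "F \<equiv> \<lambda>n k. q_binom q n k * \<rho> ^ (n - k) * poly (q_Hermite q (n - k)) y"
  shows "(case k of 0 \<Rightarrow> 0 | Suc l \<Rightarrow> F n l) + ASC_diag q \<rho> y k * F n k
      + ASC_offdiag q \<rho> k * F n (Suc k)
    = F (Suc n) k + q_int q n * F (n - 1) k"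
proof -
  define h where "h j = poly (q_Hermite q j) y" for j
  have F: "F n k = q_binom q n k * \<rho> ^ (n - k) * h (n - k)" for n k
    by (simp add: F_def h_def)
  have lower: "q_int q (Suc k) * F n (Suc k) = q_int q n * F (n - 1) k"
  proof (cases n)
    case (Suc m)
    then show ?thesis using q_binom_absorb[of q k m] by (simp add: F)
  qed (simp add: F)
  have upper: "(case k of 0 \<Rightarrow> 0 | Suc l \<Rightarrow> F n l) + ASC_diag q \<rho> y k * F n k
      = F (Suc n) k + \<rho>\<^sup>2 * q ^ k * (q_int q (Suc k) * F n (Suc k))"
  proof (cases "k \<le> n")
    case True
    define d where "d = n - k"
    have d: "Suc n - k = Suc d" "n - Suc k = d - 1" "n - k = d" using True by (auto simp: d_def)
    have yh: "y * h d = h (Suc d) + q_int q d * h (d - 1)"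
      using poly_q_Hermite_mult_x by (simp add: h_def)
    have pascal: "q_binom q (Suc n) k = (case k of 0 \<Rightarrow> 0 | Suc l \<Rightarrow> q_binom q n l)
        + q ^ k * q_binom q n k"
      by (cases k) simp_all
    have "F n l = q_binom q n l * (\<rho> ^ Suc d * h (Suc d))" if "k = Suc l" for l
      using that True by (simp add: F d_def Suc_diff_Suc)
    then have *: "(case k of 0 \<Rightarrow> 0 | Suc l \<Rightarrow> F n l) =
        (case k of 0 \<Rightarrow> 0 | Suc l \<Rightarrow> q_binom q n l) * (\<rho> ^ Suc d * h (Suc d))"
      by (cases k) simp_all
    have "ASC_diag q \<rho> y k * F n k = q ^ k * q_binom q n k * \<rho> ^ Suc d * (y * h d)"
      by (simp add: F d)
    then have "(case k of 0 \<Rightarrow> 0 | Suc l \<Rightarrow> F n l) + ASC_diag q \<rho> y k * F n k =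
        F (Suc n) k + q ^ k * q_binom q n k * h (d - 1) * (\<rho> ^ Suc d * q_int q d)"
      unfolding yh * unfolding F d pascal by (simp add: algebra_simps)
    \<comment> \<open>At d = 0 the exponent d - 1 is truncated, but \<open>q_int q 0 = 0\<close>
      kills both sides.\<close>
    also have "\<rho> ^ Suc d * q_int q d = \<rho>\<^sup>2 * \<rho> ^ (d - 1) * q_int q d"
      by (cases d) (simp_all add: power2_eq_square)
    also have "q ^ k * q_binom q n k * h (d - 1) * \<dots> =
        \<rho>\<^sup>2 * q ^ k * ((q_int q d * q_binom q n k) * \<rho> ^ (d - 1) * h (d - 1))"
      by (simp add: mult_ac)
    also have "q_int q d * q_binom q n k = q_int q (Suc k) * q_binom q n (Suc k)"
      using q_binom_step[of q k n] by (simp add: d_def)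
    finally show ?thesis by (simp add: F d mult_ac)
  next
    case False
    then show ?thesis by (cases k) (auto simp: F q_binom_eq_0)
  qed
  show ?thesis using upper lower by (simp add: algebra_simps)
qed

lemma ASC_functional_q_Hermite:
  "ASC_functional q \<rho> y k (q_Hermite q n) =
     q_binom q n k * \<rho> ^ (n - k) * poly (q_Hermite q (n - k)) y"
proof (induction n arbitrary: k rule: less_induct)
  case (less n)
  show ?case
  proof (cases n)
    case 0
    then show ?thesis by (cases k) (simp_all add: ASC_functional_def)
  next
    case (Suc m)
    then have m1: "m < n" and m2: "m - 1 < n" by auto
    \<comment> \<open>For m = 0 the truncated index gives H_0 instead of H_{-1}, with coefficient
      zero.\<close>
    have "q_Hermite q (Suc m) = pCons 0 (q_Hermite q m) - smult (q_int q m) (q_Hermite q (m - 1))"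
      by (cases m) simp_all
    then have "ASC_functional q \<rho> y k (q_Hermite q n) =
        ASC_functional q \<rho> y k (pCons 0 (q_Hermite q m))
        - q_int q m * ASC_functional q \<rho> y k (q_Hermite q (m - 1))"
      by (simp add: Suc ASC_functional_def poly_functional_diff poly_functional_smult)
    then show ?thesis
      using q_connection_recurrence[where q = q and \<rho> = \<rho> and y = y and k = k and n = m] less[OF m1] less[OF m2]
      by (simp add: ASC_functional_mult_x Suc cong: nat.case_cong)
  qed
qed

text \<open>At k = 0 the functional sends H_n to \<rho>^n H_n(y), the defining property of the
  measure with these moments.\<close>

lemma moment_eq_Jacobi_coeff:
  "moment q \<rho> y n = Jacobi_coeff (ASC_diag q \<rho> y) (ASC_offdiag q \<rho>) n 0"
proof -
  have "monom 1 n = (\<Sum>i\<le>n div 2. smult (q_Hermite_coeff q n i) (q_Hermite q (n - 2 * i)))"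
    using is_monom_expansion_q_Hermite_coeff by (simp add: is_monom_expansion_def)
  then have "ASC_functional q \<rho> y 0 (monom 1 n) =
      (\<Sum>i\<le>n div 2. q_Hermite_coeff q n i * ASC_functional q \<rho> y 0 (q_Hermite q (n - 2 * i)))"
    by (simp add: ASC_functional_def poly_functional_sum poly_functional_smult)
  then show ?thesis
    unfolding ASC_functional_q_Hermite
    by (simp add: moment_def ASC_functional_def poly_functional_monom mult_ac)
qed

theorem corollary4:
  fixes q \<rho> y :: real and n :: nat
  assumes "n \<ge> 1"
    and "det (moment_Hankel q \<rho> y n) \<noteq> 0"
  shows "det (moment_Hankel q \<rho> y (n + 1)) / det (moment_Hankel q \<rho> y n) =
    q_fact q n * (\<Prod>i=1..n. (1 - \<rho>\<^sup>2 * q ^ (i - 1)))"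
proof -
  have "det (moment_Hankel q \<rho> y m) = (\<Prod>k<m. \<Prod>i<k. ASC_offdiag q \<rho> i)" for m
    unfolding moment_Hankel_def moment_eq_Jacobi_coeff by (rule det_Hankel_Jacobi_coeff)
  \<comment> \<open>The two double products differ only by the factor with k = n.\<close>
  then have "det (moment_Hankel q \<rho> y (n + 1)) / det (moment_Hankel q \<rho> y n) =
      (\<Prod>i<n. ASC_offdiag q \<rho> i)"
    using assms(2) by simp
  also have "\<dots> = (\<Prod>i=1..n. q_int q i * (1 - \<rho>\<^sup>2 * q ^ (i - 1)))"
    by (simp add: prod.atLeast1_atMost_eq)
  finally show ?thesis by (simp add: q_fact_def prod.distrib)
qed

end
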